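(* Let $X$ be a Tychonoff space, let $Y$ be a closed subspace of $X$, and let $PG(X)$ denote either $FP(X)$ or $AP(X)$. Then the subgroup $PG(Y,X)$ of $PG(X)$ generated by $Y$ is closed in $PG(X)$.
   Context: A paratopological group is a group with a topology such that the multiplication $G\times G\to G$ is jointly continuous. The Markov free paratopological group $FP(X)$ on $X$ is a paratopological group $G$ containing $X$ as a topological subspace such that (1) $X$ generates $G$ algebraically, and (2) each continuous mapping $f:X\to H$ to a paratopological group $H$ extends to a continuous homomorphism $\hat f:G\to H$. The Markov free Abelian paratopological group $AP(X)$ is defined in the same way with all groups Abelian. As abstract groups, $FP(X)$ is the free group and $AP(X)$ is the free Abelian group on the set $X$. All spaces are assumed to be $T_0$; a Tychonoff space is a completely regular Hausdorff space. *)

theory Defs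
  imports "HOL-Analysis.Analysis" "HOL-Algebra.Generated_Groups"
begin

text \<open>All spaces are assumed to be $T_0$; this convention includes the underlying spaces of
  paratopological groups, and is made part of the definition.\<close>

definition paratopological_group :: "('g, 'm) monoid_scheme \<Rightarrow> 'g topology \<Rightarrow> bool" where
  "paratopological_group G T \<longleftrightarrow>
     group G \<and> topspace T = carrier G \<and> t0_space T \<and>
     continuous_map (prod_topology T T) T (\<lambda>(x, y). x \<otimes>\<^bsub>G\<^esub> y)"

text \<open>
  \<open>markov_free_paratopological_group X G T e\<close> says that the group \<open>G\<close> with the topology \<open>T\<close>
  is $FP(X)$, where \<open>X\<close> is identified with a subspace of \<open>G\<close> along the embedding \<open>e\<close>.

  A definition cannot quantify over the types of the test groups \<open>H\<close>. They are taken on the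
  type of words in letters $x^{\pm 1}$, with \<open>x\<close> in the type of \<open>X\<close>. This type has room for an
  isomorphic copy of every group generated by an image of \<open>X\<close>, so that the universal property
  holds for groups on every type:
  see \<open>markov_free_paratopological_group_universal\<close> below, and its Abelian analogue.
\<close>

definition markov_free_paratopological_group ::
    "'x topology \<Rightarrow> ('g, 'm) monoid_scheme \<Rightarrow> 'g topology \<Rightarrow> ('x \<Rightarrow> 'g) \<Rightarrow> bool" where
  "markov_free_paratopological_group X G T e \<longleftrightarrow>
     paratopological_group G T \<and>
     embedding_map X T e \<and>
     generate G (e ` topspace X) = carrier G \<and>
     (\<forall>(H :: (bool \<times> 'x) list monoid) U f.
        paratopological_group H U \<and> continuous_map X U f \<longrightarrow>
        (\<exists>h \<in> hom G H. continuous_map T U h \<and> (\<forall>x \<in> topspace X. h (e x) = f x)))"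

definition markov_free_abelian_paratopological_group ::
    "'x topology \<Rightarrow> ('g, 'm) monoid_scheme \<Rightarrow> 'g topology \<Rightarrow> ('x \<Rightarrow> 'g) \<Rightarrow> bool" where
  "markov_free_abelian_paratopological_group X G T e \<longleftrightarrow>
     comm_group G \<and> paratopological_group G T \<and>
     embedding_map X T e \<and>
     generate G (e ` topspace X) = carrier G \<and>
     (\<forall>(H :: (bool \<times> 'x) list monoid) U f.
        comm_group H \<and> paratopological_group H U \<and> continuous_map X U f \<longrightarrow>
        (\<exists>h \<in> hom G H. continuous_map T U h \<and> (\<forall>x \<in> topspace X. h (e x) = f x)))"

definition tychonoff_space :: "'x topology \<Rightarrow> bool" where
  "tychonoff_space X \<longleftrightarrow> completely_regular_space X \<and> Hausdorff_space X"

fun word_value :: "('g, 'm) monoid_scheme \<Rightarrow> ('x \<Rightarrow> 'g) \<Rightarrow> (bool \<times> 'x) list \<Rightarrow> 'g" where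
  "word_value H f [] = \<one>\<^bsub>H\<^esub>"
| "word_value H f ((b, x) # w) = (if b then f x else inv\<^bsub>H\<^esub> (f x)) \<otimes>\<^bsub>H\<^esub> word_value H f w"

lemma word_value_in_carrier:
  assumes "group H" "f ` A \<subseteq> carrier H" "snd ` set w \<subseteq> A"
  shows "word_value H f w \<in> carrier H"
proof -
  interpret group H by fact
  show ?thesis using assms(2,3)
    by (induction w) (auto simp: image_subset_iff)
qed

lemma word_value_append:
  assumes "group H" "f ` A \<subseteq> carrier H" "snd ` set v \<subseteq> A" "snd ` set w \<subseteq> A"
  shows "word_value H f (v @ w) = word_value H f v \<otimes>\<^bsub>H\<^esub> word_value H f w"
proof -
  interpret group H by fact
  have w: "word_value H f w \<in> carrier H"
    using assms by (intro word_value_in_carrier) auto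
  show ?thesis using assms(3)
  proof (induction v)
    case Nil then show ?case using w by simp
  next
    case (Cons a v)
    obtain b x where a: "a = (b, x)" by force
    have "word_value H f v \<in> carrier H"
      using Cons.prems assms by (intro word_value_in_carrier[where A = A]) auto
    moreover have "f x \<in> carrier H" using Cons.prems assms(2) a by auto
    ultimately show ?case using Cons w a by (auto simp: m_assoc)
  qed
qed

lemma generate_subset_word_value:
  assumes "group H" "f ` A \<subseteq> carrier H" "a \<in> generate H (f ` A)"
  shows "\<exists>w. snd ` set w \<subseteq> A \<and> word_value H f w = a"
proof -
  interpret group H by fact
  from assms(3) show ?thesis
  proof (induction rule: generate.induct)
    case one
    then show ?case by (intro exI[of _ "[]"]) auto
  next
    case (incl h)
    then obtain x where "x \<in> A" "h = f x" by auto
    then show ?case using assms(2) by (intro exI[of _ "[(True, x)]"]) auto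
  next
    case (inv h)
    then obtain x where "x \<in> A" "h = f x" by auto
    then show ?case using assms(2) by (intro exI[of _ "[(False, x)]"]) auto
  next
    case (eng h1 h2)
    then obtain v w where "snd ` set v \<subseteq> A" "word_value H f v = h1"
      "snd ` set w \<subseteq> A" "word_value H f w = h2" by auto
    then show ?case using word_value_append[OF assms(1,2)]
      by (intro exI[of _ "v @ w"]) auto
  qed
qed

lemma paratopological_group_on_words:
  fixes H :: "('h, 'n) monoid_scheme" and X :: "'x topology"
  assumes H: "paratopological_group H U" and f: "continuous_map X U f"
  obtains K :: "(bool \<times> 'x) list monoid" and V g k
  where "paratopological_group K V" "continuous_map X V g" "k \<in> hom K H" "continuous_map V U k"
    "\<forall>x \<in> topspace X. k (g x) = f x" "comm_group H \<longrightarrow> comm_group K"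
proof -
  interpret group H using H by (simp add: paratopological_group_def)
  define S where "S = generate H (f ` topspace X)"
  define r where "r a = (SOME w. word_value H f w = a)" for a
  define k where "k = word_value H f"
  define K where "K = \<lparr>carrier = r ` S, mult = \<lambda>u v. r (k u \<otimes>\<^bsub>H\<^esub> k v), one = r \<one>\<^bsub>H\<^esub>\<rparr>"
  define V where "V = pullback_topology (r ` S) k U"
  have top: "topspace U = carrier H" using H by (simp add: paratopological_group_def)
  have im: "f ` topspace X \<subseteq> carrier H"
    using f top by (metis continuous_map_image_subset_topspace)
  have sub: "subgroup S H" unfolding S_def by (rule generate_is_subgroup[OF im])
  note SC = subgroup.mem_carrier[OF sub]
  have kr: "k (r a) = a" if "a \<in> S" for a
    using generate_subset_word_value[OF is_group im, of a] that someI_ex[of "\<lambda>w. word_value H f w = a"]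
    unfolding S_def r_def k_def by blast
  have K[simp]: "carrier K = r ` S" "\<And>u v. u \<otimes>\<^bsub>K\<^esub> v = r (k u \<otimes>\<^bsub>H\<^esub> k v)" "\<one>\<^bsub>K\<^esub> = r \<one>\<^bsub>H\<^esub>"
    by (simp_all add: K_def)
  note S = subgroup.m_closed[OF sub] subgroup.one_closed[OF sub] subgroup.m_inv_closed[OF sub]
  have gK: "group K"
  proof (rule groupI)
    show "\<exists>y\<in>carrier K. y \<otimes>\<^bsub>K\<^esub> x = \<one>\<^bsub>K\<^esub>" if "x \<in> carrier K" for x
      using that by (auto simp: kr S SC intro!: bexI[of _ "inv\<^bsub>H\<^esub> (k x)"])
  qed (auto simp: kr S SC m_assoc)
  have comm: "comm_group K" if "comm_group H"
  proof -
    interpret HC: comm_group H by fact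
    show ?thesis
      by (rule group.group_comm_groupI[OF gK]) (auto simp: kr SC HC.m_comm)
  qed
  have tV: "topspace V = r ` S"
    unfolding V_def topspace_pullback_topology by (auto simp: kr SC top)
  have kV: "continuous_map V U k"
    unfolding V_def using continuous_map_pullback[OF continuous_map_id, of "r ` S" k U] by simp
  have khom: "k \<in> hom K H"
    by (auto simp: hom_def kr S SC)
  have t0: "t0_space V"
    unfolding t0_space_def
  proof (intro ballI impI)
    fix x y assume xy: "x \<in> topspace V" "y \<in> topspace V" "x \<noteq> y"
    then have "k x \<noteq> k y" "k x \<in> topspace U" "k y \<in> topspace U"
      using kr SC by (auto simp: tV top)
    then obtain W where W: "openin U W" "k x \<notin> W \<longleftrightarrow> k y \<in> W"
      using H unfolding paratopological_group_def t0_space_def by blast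
    show "\<exists>W. openin V W \<and> (x \<notin> W \<longleftrightarrow> y \<in> W)"
      using W xy unfolding tV
      by (intro exI[of _ "k -` W \<inter> r ` S"]) (auto simp: V_def openin_pullback_topology)
  qed
  have mult: "continuous_map (prod_topology V V) V (\<lambda>(x, y). x \<otimes>\<^bsub>K\<^esub> y)"
  proof -
    have "continuous_map (prod_topology V V) (prod_topology U U) (\<lambda>(x, y). (k x, k y))"
      using kV by (simp add: continuous_map_prod_top)
    moreover have "continuous_map (prod_topology U U) U (\<lambda>(x, y). x \<otimes>\<^bsub>H\<^esub> y)"
      using H by (simp add: paratopological_group_def)
    ultimately have *: "continuous_map (prod_topology V V) U
        ((\<lambda>(x, y). x \<otimes>\<^bsub>H\<^esub> y) \<circ> (\<lambda>(x, y). (k x, k y)))"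
      by (rule continuous_map_compose)
    have "continuous_map (prod_topology V V) U (k \<circ> (\<lambda>(x, y). x \<otimes>\<^bsub>K\<^esub> y))"
      by (rule continuous_map_eq[OF *]) (auto simp: tV kr S SC)
    then show ?thesis unfolding V_def
      by (rule continuous_map_pullback') (auto simp: tV[unfolded V_def] kr S)
  qed
  have fS: "f x \<in> S" if "x \<in> topspace X" for x
    using that unfolding S_def by (auto intro: generate.incl)
  have g: "continuous_map X V (r \<circ> f)"
  proof -
    have "continuous_map X U (k \<circ> (r \<circ> f))"
      by (rule continuous_map_eq[OF f]) (auto simp: kr fS)
    then show ?thesis unfolding V_def
      by (rule continuous_map_pullback') (auto simp: fS)
  qed
  have "paratopological_group K V"
    unfolding paratopological_group_def K(1) by (intro conjI gK tV t0 mult)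
  moreover have "\<forall>x \<in> topspace X. k ((r \<circ> f) x) = f x" by (simp add: kr fS)
  ultimately show ?thesis using that g khom kV comm by blast
qed

lemma markov_free_paratopological_group_universal:
  fixes H :: "('h, 'n) monoid_scheme"
  assumes G: "markov_free_paratopological_group X G T e"
    and H: "paratopological_group H U" and f: "continuous_map X U f"
  shows "\<exists>h \<in> hom G H. continuous_map T U h \<and> (\<forall>x \<in> topspace X. h (e x) = f x)"
proof -
  obtain K :: "(bool \<times> 'a) list monoid" and V g k
    where K: "paratopological_group K V" "continuous_map X V g" "k \<in> hom K H" "continuous_map V U k"
      "\<forall>x \<in> topspace X. k (g x) = f x"
    using paratopological_group_on_words[OF H f] by metis
  then obtain h where "h \<in> hom G K" "continuous_map T V h" "\<forall>x \<in> topspace X. h (e x) = g x"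
    using G unfolding markov_free_paratopological_group_def by blast
  then show ?thesis using K
    by (intro bexI[of _ "k \<circ> h"]) (auto intro: continuous_map_compose hom_compose)
qed

lemma markov_free_abelian_paratopological_group_universal:
  fixes H :: "('h, 'n) monoid_scheme"
  assumes G: "markov_free_abelian_paratopological_group X G T e"
    and C: "comm_group H" and H: "paratopological_group H U" and f: "continuous_map X U f"
  shows "\<exists>h \<in> hom G H. continuous_map T U h \<and> (\<forall>x \<in> topspace X. h (e x) = f x)"
proof -
  obtain K :: "(bool \<times> 'a) list monoid" and V g k
    where K: "paratopological_group K V" "continuous_map X V g" "k \<in> hom K H" "continuous_map V U k"
      "\<forall>x \<in> topspace X. k (g x) = f x" "comm_group K"
    using paratopological_group_on_words[OF H f] C by metis
  then obtain h where "h \<in> hom G K" "continuous_map T V h" "\<forall>x \<in> topspace X. h (e x) = g x"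
    using G unfolding markov_free_abelian_paratopological_group_def by blast
  then show ?thesis using K
    by (intro bexI[of _ "k \<circ> h"]) (auto intro: continuous_map_compose hom_compose)
qed

end

theory Submission
  imports Defs
begin

text \<open>
  For every \<open>g\<close> outside the subgroup generated by \<open>Y\<close> there is a continuous real function on the
  free group that vanishes on this subgroup but not at \<open>g\<close>. In the Abelian case
  \<open>g = x\<^sup>n h\<close> with \<open>n \<noteq> 0\<close>, \<open>x \<notin> Y\<close> and \<open>h\<close> generated by \<open>Y\<close> and finitely many
  points other than \<open>x\<close>; extend a real function on \<open>X\<close> that is \<open>1\<close> at \<open>x\<close> and \<open>0\<close> on \<open>Y\<close> and at
  those points. In the non-Abelian case write \<open>g\<close> as a reduced product of powers of letters and
  extend \<open>x \<mapsto> 1 + (\<Sum>z. \<phi>\<^sub>z(x) z)\<close>, where \<open>z\<close> ranges over the letters of \<open>g\<close> and the \<open>\<phi>\<^sub>z\<close> are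
  suitable Urysohn functions, to a homomorphism into the group of formal power series in
  noncommuting variables with constant term \<open>1\<close>. As in Magnus' embedding of free groups, the
  coefficient at the word of the letters of \<open>g\<close> is the product of the exponents at \<open>g\<close>, and it
  vanishes on the subgroup generated by \<open>Y\<close> since one of the letters is not in \<open>Y\<close>.
\<close>

section \<open>Formal power series in noncommuting variables\<close>

text \<open>The Cauchy product: the coefficient at \<open>w\<close> is the sum of
  \<open>s u * t v\<close> over all splittings of \<open>w\<close> into \<open>u @ v\<close>. The
  recursion separates the splitting with empty \<open>u\<close> from those in which \<open>u\<close>
  begins with \<open>x\<close>.\<close>

fun conv :: "('x list \<Rightarrow> real) \<Rightarrow> ('x list \<Rightarrow> real) \<Rightarrow> 'x list \<Rightarrow> real" where
  "conv s t [] = s [] * t []"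
| "conv s t (x # w) = s [] * t (x # w) + conv (\<lambda>v. s (x # v)) t w"

lemma conv_zero_left: "conv (\<lambda>v. 0) t w = 0"
  by (induction w) auto

lemma conv_add_left: "conv (\<lambda>v. s v + s' v) t w = conv s t w + conv s' t w"
  by (induction w arbitrary: s s') (auto simp: algebra_simps)

lemma conv_scale_left: "conv (\<lambda>v. c * s v) t w = c * conv s t w"
  by (induction w arbitrary: s) (auto simp: algebra_simps)

text \<open>Shifting \<open>conv s t\<close> by a letter gives a multiple of the shifted
  \<open>t\<close> plus the product of the shifted \<open>s\<close> with \<open>t\<close>. Linearity
  in the left factor then reduces the claim to a shorter word.\<close>

lemma conv_assoc: "conv (conv s t) u w = conv s (conv t u) w"
proof (induction w arbitrary: s)
  case (Cons x w)
  have "conv (\<lambda>v. conv s t (x # v)) u w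
      = s [] * conv (\<lambda>v. t (x # v)) u w + conv (conv (\<lambda>v. s (x # v)) t) u w"
    by (simp add: conv_add_left conv_scale_left)
  then show ?case by (simp add: Cons algebra_simps)
qed simp

definition series_one :: "'x list \<Rightarrow> real" where
  "series_one w = (if w = [] then 1 else 0)"

lemma conv_one_left: "conv series_one t w = t w"
  by (cases w) (auto simp: series_one_def conv_zero_left)

text \<open>If the constant term of \<open>s\<close> is \<open>1\<close>, then \<open>left_quotient s r\<close> is the solution \<open>t\<close> of
  \<open>conv t s = r\<close>.\<close>

fun left_quotient :: "('x list \<Rightarrow> real) \<Rightarrow> ('x list \<Rightarrow> real) \<Rightarrow> 'x list \<Rightarrow> real" where
  "left_quotient s r [] = r []"
| "left_quotient s r (x # w) = left_quotient s (\<lambda>v. r (x # v) - r [] * s (x # v)) w"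

text \<open>The constant term of the solution is \<open>r []\<close>. Once its contribution is
  subtracted from the shifted \<open>r\<close>, the shifted solution satisfies an equation of the
  same form.\<close>

lemma conv_left_quotient:
  assumes "s [] = 1"
  shows "conv (left_quotient s r) s w = r w"
  using assms by (induction w arbitrary: r) auto

lemma left_quotient_zero: "left_quotient s (\<lambda>v. 0) w = 0"
  by (induction w) auto

definition series_group :: "('x list \<Rightarrow> real) monoid" where
  "series_group = \<lparr>carrier = {s. s [] = 1}, mult = conv, one = series_one\<rparr>"

lemma series_group_simps [simp]:
  "s \<in> carrier series_group \<longleftrightarrow> s [] = 1"
  "s \<otimes>\<^bsub>series_group\<^esub> t = conv s t"
  "\<one>\<^bsub>series_group\<^esub> = series_one"
  by (simp_all add: series_group_def)

lemma group_series_group: "group series_group"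
proof (rule groupI)
  fix s :: "'x list \<Rightarrow> real"
  assume "s \<in> carrier series_group"
  then show "\<exists>t\<in>carrier series_group. t \<otimes>\<^bsub>series_group\<^esub> s = \<one>\<^bsub>series_group\<^esub>"
    by (intro bexI[of _ "left_quotient s series_one"])
      (auto simp: series_one_def conv_left_quotient)
qed (auto simp: conv_assoc conv_one_left series_one_def fun_eq_iff)

lemma inv_series_group:
  assumes "s [] = 1"
  shows "inv\<^bsub>series_group\<^esub> s = left_quotient s series_one"
  using assms group.inv_equality[OF group_series_group, of "left_quotient s series_one" s]
  by (auto simp: conv_left_quotient series_one_def fun_eq_iff)

section \<open>Topology of coefficientwise convergence\<close>

definition series_topology :: "('x list \<Rightarrow> real) topology" where
  "series_topology = subtopology (powertop_real UNIV) (carrier series_group)"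

lemma topspace_series_topology: "topspace series_topology = carrier series_group"
  by (simp add: series_topology_def)

lemma continuous_map_series_topology:
  "continuous_map Z series_topology f \<longleftrightarrow>
     (\<forall>w. continuous_map Z euclideanreal (\<lambda>z. f z w)) \<and> f \<in> topspace Z \<rightarrow> carrier series_group"
  unfolding series_topology_def continuous_map_in_subtopology
  by (simp add: continuous_map_componentwise_UNIV image_subset_iff_funcset)

text \<open>A coefficient of the product is a polynomial in finitely many coefficients of the
  factors.\<close>

lemma continuous_map_conv:
  assumes "\<And>v. continuous_map Z euclideanreal (\<lambda>z. s z v)"
    and "\<And>v. continuous_map Z euclideanreal (\<lambda>z. t z v)"
  shows "continuous_map Z euclideanreal (\<lambda>z. conv (s z) (t z) w)"
  using assms(1)
proof (induction w arbitrary: s)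
  case Nil
  then show ?case using assms(2) by (auto intro!: continuous_intros)
next
  case (Cons x w)
  have "continuous_map Z euclideanreal (\<lambda>z. conv (\<lambda>v. s z (x # v)) (t z) w)"
    by (rule Cons.IH) (rule Cons.prems)
  then show ?case
    using Cons.prems assms(2) by (simp add: continuous_map_add continuous_map_real_mult)
qed

lemma paratopological_group_series: "paratopological_group series_group series_topology"
proof -
  have "Hausdorff_space (powertop_real (UNIV :: 'x list set))"
    by (simp add: Hausdorff_space_product_topology)
  then have "t0_space (series_topology :: ('x list \<Rightarrow> real) topology)"
    unfolding series_topology_def
    by (intro t1_imp_t0_space Hausdorff_imp_t1_space Hausdorff_space_subtopology)
  moreover have "continuous_map (prod_topology series_topology series_topology) series_topology
      (\<lambda>(s, t). conv s t :: 'x list \<Rightarrow> real)"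
  proof -
    let ?P = "prod_topology series_topology (series_topology :: ('x list \<Rightarrow> real) topology)"
    have "continuous_map ?P series_topology fst" "continuous_map ?P series_topology snd"
      by (simp_all add: continuous_map_fst continuous_map_snd)
    then show ?thesis
      unfolding continuous_map_series_topology
      by (auto simp: case_prod_unfold topspace_series_topology intro!: continuous_map_conv)
  qed
  ultimately show ?thesis
    by (simp add: paratopological_group_def group_series_group topspace_series_topology)
qed

section \<open>Series supported on the words over a set of letters\<close>

definition series_over :: "'x set \<Rightarrow> ('x list \<Rightarrow> real) set" where
  "series_over A = {s. s [] = 1 \<and> (\<forall>w. \<not> set w \<subseteq> A \<longrightarrow> s w = 0)}"

text \<open>If \<open>w\<close> has a letter outside \<open>A\<close>, so has one part of every
  splitting of \<open>w\<close>.\<close>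

lemma conv_outside:
  assumes "\<And>v. \<not> set v \<subseteq> A \<Longrightarrow> s v = 0" "\<And>v. \<not> set v \<subseteq> A \<Longrightarrow> t v = 0" "\<not> set w \<subseteq> A"
  shows "conv s t w = 0"
  using assms(1,3)
proof (induction w arbitrary: s)
  case (Cons x w)
  show ?case
  proof (cases "x \<in> A")
    case True
    then have "conv (\<lambda>v. s (x # v)) t w = 0"
      using Cons by auto
    then show ?thesis using Cons(3) assms(2)[of "x # w"] by simp
  next
    case False
    then have "(\<lambda>v. s (x # v)) = (\<lambda>v. 0)"
      using Cons(2) by auto
    then show ?thesis using Cons(3) assms(2)[of "x # w"] by (simp add: conv_zero_left)
  qed
qed simp

text \<open>For a first letter in \<open>A\<close> the new right-hand side of the recursion is again
  supported on words over \<open>A\<close>; for any other first letter it is zero.\<close>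

lemma left_quotient_outside:
  assumes "\<And>v. \<not> set v \<subseteq> A \<Longrightarrow> s v = 0" "\<And>v. \<not> set v \<subseteq> A \<Longrightarrow> r v = 0" "\<not> set w \<subseteq> A"
  shows "left_quotient s r w = 0"
  using assms(2,3)
proof (induction w arbitrary: r)
  case (Cons x w)
  show ?case
  proof (cases "x \<in> A")
    case True
    then show ?thesis using Cons assms(1) by auto
  next
    case False
    then have "(\<lambda>v. r (x # v) - r [] * s (x # v)) = (\<lambda>v. 0)"
      using Cons(2) assms(1) by auto
    then show ?thesis by (simp add: left_quotient_zero)
  qed
qed simp

text \<open>Used for \<open>A = {x}\<close>, to control the powers of the image of a letter
  \<open>x\<close>, and for \<open>A = Y\<close>, to control the image of the subgroup generated by
  \<open>Y\<close>.\<close>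

lemma subgroup_series_over: "subgroup (series_over A) series_group"
proof (rule subgroup.intro)
  show "\<one>\<^bsub>series_group\<^esub> \<in> series_over A"
    by (auto simp: series_over_def series_one_def)
next
  fix s t assume "s \<in> series_over A" "t \<in> series_over A"
  then show "s \<otimes>\<^bsub>series_group\<^esub> t \<in> series_over A"
    by (auto simp: series_over_def intro!: conv_outside[where A = A])
next
  fix s assume s: "s \<in> series_over A"
  then have "left_quotient s series_one w = 0" if "\<not> set w \<subseteq> A" for w
    using that by (intro left_quotient_outside[where A = A]) (auto simp: series_over_def series_one_def)
  with s show "inv\<^bsub>series_group\<^esub> s \<in> series_over A"
    by (simp add: series_over_def inv_series_group series_one_def)
qed (auto simp: series_over_def)

text \<open>Only prefixes that are powers of \<open>x\<close> contribute. In a word without equal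
  neighbours these are the empty prefix and, if the word starts with \<open>x\<close>, the prefix
  \<open>[x]\<close>.\<close>

lemma conv_distinct_adj:
  assumes "s \<in> series_over {x}" "distinct_adj (y # w)"
  shows "conv s t (y # w) = t (y # w) + (if y = x then s [x] * t w else 0)"
proof -
  have out: "s v = 0" if "\<not> set v \<subseteq> {x}" for v
    using assms(1) that by (simp add: series_over_def)
  have one: "s [] = 1" using assms(1) by (simp add: series_over_def)
  show ?thesis
  proof (cases w)
    case Nil
    then show ?thesis using out[of "[y]"] one by auto
  next
    case (Cons z v)
    have "s (y # z # u) = 0" for u
      using assms(2) Cons by (intro out) auto
    moreover have "s [y] = 0" if "y \<noteq> x" using out that by simp
    ultimately show ?thesis using one Cons by (auto simp: conv_zero_left)
  qed
qed

text \<open>On series with constant term 1 the coefficient at \<open>[x]\<close> turns products into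
  sums.\<close>

lemma coeff_singleton_pow:
  fixes s :: "'x list \<Rightarrow> real"
  assumes "s [] = 1"
  shows "(s [^]\<^bsub>series_group\<^esub> (n :: int)) [x] = n * s [x]"
proof -
  have pn: "(s [^]\<^bsub>series_group\<^esub> (k :: nat)) [] = 1 \<and> (s [^]\<^bsub>series_group\<^esub> k) [x] = k * s [x]" for k
    using assms by (induction k) (auto simp: nat_pow_def series_one_def algebra_simps)
  have inv: "(inv\<^bsub>series_group\<^esub> t) [x] = - t [x]" if "t [] = 1" for t :: "'x list \<Rightarrow> real"
    by (simp add: inv_series_group[of t, OF that] series_one_def)
  show ?thesis
  proof (cases "n < 0")
    case True
    then have "(s [^]\<^bsub>series_group\<^esub> n) [x] = - (nat (- n) * s [x])"
      unfolding int_pow_def2 using pn inv by presburger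
    with True show ?thesis by simp
  next
    case False
    then have "(s [^]\<^bsub>series_group\<^esub> n) [x] = nat n * s [x]"
      unfolding int_pow_def2 using pn by presburger
    with False show ?thesis by simp
  qed
qed

section \<open>Reduced products of powers\<close>

definition syllables_value :: "('g, 'm) monoid_scheme \<Rightarrow> ('x \<Rightarrow> 'g) \<Rightarrow> ('x \<times> int) list \<Rightarrow> 'g" where
  "syllables_value H f l = foldr (\<lambda>(x, n) a. f x [^]\<^bsub>H\<^esub> n \<otimes>\<^bsub>H\<^esub> a) l \<one>\<^bsub>H\<^esub>"

lemma syllables_value_simps [simp]:
  "syllables_value H f [] = \<one>\<^bsub>H\<^esub>"
  "syllables_value H f ((x, n) # l) = f x [^]\<^bsub>H\<^esub> n \<otimes>\<^bsub>H\<^esub> syllables_value H f l"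
  by (simp_all add: syllables_value_def)

lemma syllables_value_in_subgroup:
  assumes "group H" "subgroup S H" "f ` fst ` set l \<subseteq> S"
  shows "syllables_value H f l \<in> S"
proof -
  interpret group H by fact
  show ?thesis using assms(3)
    by (induction l)
      (auto intro!: subgroup.m_closed[OF assms(2)] subgroup.one_closed[OF assms(2)]
        subgroup_int_pow_closed[OF assms(2)])
qed

lemma hom_syllables_value:
  assumes "group H" "group K" "h \<in> hom H K" "f ` fst ` set l \<subseteq> carrier H"
  shows "h (syllables_value H f l) = syllables_value K (h \<circ> f) l"
proof -
  interpret group_hom H K h
    using assms by (simp add: group_hom_def group_hom_axioms_def)
  show ?thesis using assms(4)
  proof (induction l)
    case (Cons p l)
    have "syllables_value H f l \<in> carrier H"
      using Cons.prems by (intro syllables_value_in_subgroup G.subgroup_self assms(1)) auto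
    then show ?case using Cons by (cases p) (auto simp: hom_int_pow)
  qed simp
qed

definition reduced_syllables :: "('x \<times> int) list \<Rightarrow> bool" where
  "reduced_syllables l \<longleftrightarrow> 0 \<notin> snd ` set l \<and> distinct_adj (map fst l)"

text \<open>A word is reduced from the right: each new letter either merges with the first syllable
  or becomes a syllable of its own.\<close>

lemma generate_reduced_syllables:
  assumes "group H" "f ` A \<subseteq> carrier H" "a \<in> generate H (f ` A)"
  obtains l where "fst ` set l \<subseteq> A" "reduced_syllables l" "syllables_value H f l = a"
proof -
  interpret group H by fact
  have "\<exists>l. fst ` set l \<subseteq> A \<and> reduced_syllables l \<and> syllables_value H f l = word_value H f w"
    if "snd ` set w \<subseteq> A" for w
    using that
  proof (induction w)
    case Nil
    then show ?case by (intro exI[of _ "[]"]) (simp add: reduced_syllables_def)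
  next
    case (Cons p w)
    obtain b x where p: "p = (b, x)" by force
    define k :: int where "k = (if b then 1 else -1)"
    have x: "x \<in> A" and fx: "f x \<in> carrier H" using Cons.prems assms(2) p by auto
    obtain l where l: "fst ` set l \<subseteq> A" "reduced_syllables l"
      "syllables_value H f l = word_value H f w"
      using Cons by auto
    have val: "word_value H f (p # w) = f x [^]\<^bsub>H\<^esub> k \<otimes>\<^bsub>H\<^esub> syllables_value H f l"
      using fx l by (auto simp: p k_def int_pow_neg)
    have lc: "syllables_value H f l' \<in> carrier H" if "fst ` set l' \<subseteq> A" for l'
      using that assms(2) by (intro syllables_value_in_subgroup subgroup_self assms(1)) auto
    show ?case
    proof (cases "\<exists>n r. l = (x, n) # r")
      case True
      then obtain n r where r: "l = (x, n) # r" by auto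
      have rA: "fst ` set r \<subseteq> A" using l r by auto
      have eq: "word_value H f (p # w) = f x [^]\<^bsub>H\<^esub> (k + n) \<otimes>\<^bsub>H\<^esub> syllables_value H f r"
        using fx lc[OF rA] by (simp add: val r int_pow_mult m_assoc)
      show ?thesis
      \<comment> \<open>If the exponents cancel, the syllable disappears and the tail
        \<open>r\<close> is already reduced. Otherwise the first letter of \<open>r\<close> still
        differs from \<open>x\<close>.\<close>
      proof (cases "k + n = 0")
        case True
        then show ?thesis using l r rA eq lc[OF rA]
          by (intro exI[of _ r]) (auto simp: reduced_syllables_def distinct_adj_Cons)
      next
        case False
        then show ?thesis using l r rA eq x
          by (intro exI[of _ "(x, k + n) # r"]) (auto simp: reduced_syllables_def distinct_adj_Cons)
      qed
    next
      case False
      then have "reduced_syllables ((x, k) # l)"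
        using l(2) by (cases l) (auto simp: reduced_syllables_def k_def)
      then show ?thesis using l x val by (intro exI[of _ "(x, k) # l"]) auto
    qed
  qed
  then show ?thesis
    using generate_subset_word_value[OF assms] that by metis
qed

section \<open>Coefficients of products of powers\<close>

text \<open>Each factor accounts for at most one letter of a word without equal neighbours, so the
  word cannot have more letters than there are factors.\<close>

lemma coeff_syllables_value_eq_0:
  assumes "\<And>x. x \<in> fst ` set l \<Longrightarrow> f x \<in> series_over {x}"
    and "distinct_adj w" "length l < length w"
  shows "syllables_value series_group f l w = 0"
  using assms
proof (induction l arbitrary: w)
  case Nil
  then show ?case by (auto simp: series_one_def)
next
  case (Cons p l)
  obtain x n where p: "p = (x, n)" by force
  obtain y v where w: "w = y # v" using Cons.prems by (cases w) auto
  have "f x [^]\<^bsub>series_group\<^esub> n \<in> series_over {x}"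
    using Cons.prems(1) p
    by (intro group.subgroup_int_pow_closed[OF group_series_group] subgroup_series_over) auto
  then show ?case
    using Cons by (auto simp: p w conv_distinct_adj distinct_adj_Cons simp del: conv.simps)
qed

text \<open>The only splitting that contributes takes exactly one letter from each factor, and a
  factor with exponent \<open>n\<close> contributes \<open>n\<close>.\<close>

lemma coeff_syllables_value:
  assumes "\<And>x. x \<in> fst ` set l \<Longrightarrow> f x \<in> series_over {x} \<and> f x [x] = 1"
    and "distinct_adj (map fst l)"
  shows "syllables_value series_group f l (map fst l) = (\<Prod>n\<leftarrow>map snd l. real_of_int n)"
  using assms
proof (induction l)
  case Nil
  then show ?case by (auto simp: series_one_def)
next
  case (Cons p l)
  obtain x n where p: "p = (x, n)" by force
  have fx: "f x \<in> series_over {x}" "f x [x] = 1" "f x [] = 1"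
    using Cons.prems(1)[of x] p by (auto simp: series_over_def)
  have "f x [^]\<^bsub>series_group\<^esub> n \<in> series_over {x}"
    by (intro group.subgroup_int_pow_closed[OF group_series_group] subgroup_series_over fx)
  \<comment> \<open>If the first factor contributes only its constant term, one factor too few
    remains for the whole word.\<close>
  moreover have "syllables_value series_group f l (map fst (p # l)) = 0"
    using Cons.prems by (intro coeff_syllables_value_eq_0) auto
  moreover have "syllables_value series_group f l (map fst l) = (\<Prod>n\<leftarrow>map snd l. real_of_int n)"
    using Cons by (auto simp: distinct_adj_Cons)
  ultimately show ?case
    using Cons.prems(2) fx
    by (simp add: p conv_distinct_adj coeff_singleton_pow del: conv.simps)
qed

section \<open>Separating points from the subgroup\<close>

lemma tychonoff_urysohn:
  assumes "tychonoff_space X" "closedin X S" "x \<in> topspace X - S"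
  obtains \<phi> where "continuous_map X euclideanreal \<phi>" "\<phi> x = 1" "\<And>y. y \<in> S \<Longrightarrow> \<phi> y = 0"
proof -
  obtain f where f: "continuous_map X (top_of_set {0..1::real}) f" "f x = 0" "f ` S \<subseteq> {1}"
    using assms unfolding tychonoff_space_def completely_regular_space_def by blast
  then have "continuous_map X euclideanreal (\<lambda>y. 1 - f y)"
    by (auto simp: continuous_map_in_subtopology intro!: continuous_intros)
  then show ?thesis using f by (intro that[of "\<lambda>y. 1 - f y"]) auto
qed

text \<open>The sets where such a function \<open>c\<close> is nonzero are open and cover the
  complement of \<open>K\<close>.\<close>

lemma closedin_real_separated:
  assumes "K \<subseteq> topspace T"
    and "\<And>g. g \<in> topspace T - K \<Longrightarrow>
      \<exists>c. continuous_map T euclideanreal c \<and> c g \<noteq> 0 \<and> (\<forall>k\<in>K. c k = 0)"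
  shows "closedin T K"
  unfolding closedin_def
proof (intro conjI assms(1), subst openin_subopen, intro ballI)
  fix g assume g: "g \<in> topspace T - K"
  then obtain c where c: "continuous_map T euclideanreal c" "c g \<noteq> 0" "\<forall>k\<in>K. c k = 0"
    using assms(2) by blast
  have "openin T {x \<in> topspace T. c x \<in> - {0}}"
    by (rule openin_continuous_map_preimage[OF c(1)]) auto
  then show "\<exists>U. openin T U \<and> g \<in> U \<and> U \<subseteq> topspace T - K"
    using g c by (intro exI[of _ "{x \<in> topspace T. c x \<in> - {0}}"]) auto
qed

lemma hom_generate_in_subgroup:
  assumes "group G" "group H" "h \<in> hom G H" "subgroup S H" "A \<subseteq> carrier G" "h ` A \<subseteq> S"
    and "a \<in> generate G A"
  shows "h a \<in> S"
proof -
  interpret group_hom G H h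
    using assms by (simp add: group_hom_def group_hom_axioms_def)
  have "h ` generate G A \<subseteq> S"
    using generate_img[OF assms(5)] H.generate_subgroup_incl[OF assms(6,4)] by simp
  then show ?thesis using assms(7) by blast
qed

lemma embedding_map_image_subset:
  assumes "embedding_map X T e"
  shows "e ` topspace X \<subseteq> topspace T"
  using assms homeomorphic_imp_surjective_map[of X "subtopology T (e ` topspace X)" e]
  by (auto simp: embedding_map_def)

section \<open>The non-Abelian case\<close>

lemma free_separation:
  assumes X: "tychonoff_space X" and Y: "closedin X Y"
    and FP: "markov_free_paratopological_group X G T e"
    and g: "g \<in> carrier G - generate G (e ` Y)"
  shows "\<exists>c. continuous_map T euclideanreal c \<and> c g \<noteq> 0 \<and> (\<forall>k\<in>generate G (e ` Y). c k = 0)"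
proof -
  have G: "group G" and gen: "generate G (e ` topspace X) = carrier G"
    and eX: "e ` topspace X \<subseteq> carrier G"
    using FP embedding_map_image_subset[of X T e]
    by (auto simp: markov_free_paratopological_group_def paratopological_group_def)
  have YX: "Y \<subseteq> topspace X" using Y by (rule closedin_subset)
  have eY: "e ` Y \<subseteq> carrier G" using eX YX by auto
  obtain l where l: "fst ` set l \<subseteq> topspace X" "reduced_syllables l" "syllables_value G e l = g"
    using generate_reduced_syllables[OF G eX, of g] g gen by auto
  define L where "L = fst ` set l"
  have "\<not> L \<subseteq> Y"
  proof
    assume "L \<subseteq> Y"
    then have "syllables_value G e l \<in> generate G (e ` Y)"
      by (intro syllables_value_in_subgroup G group.generate_is_subgroup eY)
        (auto simp: L_def intro: generate.incl)
    with l g show False by simp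
  qed
  \<comment> \<open>Vanishing at the other letters of \<open>g\<close> makes the series of a letter
    \<open>z\<close> equal to 1 + \<open>z\<close>. Vanishing on \<open>Y\<close> for
    \<open>z\<close> outside \<open>Y\<close> keeps the letters outside \<open>Y\<close> out of the
    series of points of \<open>Y\<close>; for \<open>z\<close> in \<open>Y\<close> it would
    contradict the value 1 at \<open>z\<close>.\<close>
  have "\<forall>z\<in>L. \<exists>\<phi>. continuous_map X euclideanreal \<phi> \<and> \<phi> z = 1 \<and>
      (\<forall>y \<in> (L - {z}) \<union> (if z \<in> Y then {} else Y). \<phi> y = 0)"
  proof
    fix z assume z: "z \<in> L"
    have "closedin X (L - {z})"
      using X l(1) by (intro closedin_Hausdorff_finite) (auto simp: tychonoff_space_def L_def)
    then have "closedin X ((L - {z}) \<union> (if z \<in> Y then {} else Y))"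
      using Y by (intro closedin_Un) auto
    moreover have "z \<in> topspace X - ((L - {z}) \<union> (if z \<in> Y then {} else Y))"
      using z l(1) by (auto simp: L_def)
    ultimately show "\<exists>\<phi>. continuous_map X euclideanreal \<phi> \<and> \<phi> z = 1 \<and>
        (\<forall>y \<in> (L - {z}) \<union> (if z \<in> Y then {} else Y). \<phi> y = 0)"
      using tychonoff_urysohn[OF X] by metis
  qed
  then obtain \<phi> where \<phi>: "\<And>z. z \<in> L \<Longrightarrow> continuous_map X euclideanreal (\<phi> z)"
    "\<And>z. z \<in> L \<Longrightarrow> \<phi> z z = 1"
    "\<And>y z. z \<in> L \<Longrightarrow> y \<in> (L - {z}) \<union> (if z \<in> Y then {} else Y) \<Longrightarrow> \<phi> z y = 0"
    by metis
  define f where "f x w = (if w = [] then 1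
    else if length w = 1 \<and> hd w \<in> L then \<phi> (hd w) x else 0)" for x w
  \<comment> \<open>A letter \<open>z\<close> occurs in the series \<open>f x\<close> only if it
    lies in \<open>L\<close> and \<open>\<phi> z x\<close> is nonzero.\<close>
  have f: "f x \<in> series_over A" if "\<And>z. z \<in> L - A \<Longrightarrow> \<phi> z x = 0" for x A
    using that by (fastforce simp: series_over_def f_def length_Suc_conv)
  have "continuous_map X euclideanreal (\<lambda>x. f x w)" for w
    by (cases "w = []"; cases "length w = 1 \<and> hd w \<in> L") (auto simp: f_def \<phi>(1))
  then have "continuous_map X series_topology f"
    by (auto simp: continuous_map_series_topology f_def)
  then obtain h where h: "h \<in> hom G series_group" "continuous_map T series_topology h"
    "\<And>x. x \<in> topspace X \<Longrightarrow> h (e x) = f x"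
    using markov_free_paratopological_group_universal[OF FP paratopological_group_series] by metis
  have "h g (map fst l) \<noteq> 0"
  proof -
    have "h g = syllables_value series_group (h \<circ> e) l"
      using hom_syllables_value[OF G group_series_group h(1), of e l] l eX by auto
    moreover have "(h \<circ> e) x \<in> series_over {x} \<and> (h \<circ> e) x [x] = 1" if "x \<in> fst ` set l" for x
    proof -
      have "x \<in> L" "h (e x) = f x" using that l(1) h(3) by (auto simp: L_def)
      then show ?thesis using \<phi>(2,3) by (auto simp: f_def intro!: f)
    qed
    \<comment> \<open>No exponent of a reduced expression is 0.\<close>
    moreover have "(\<Prod>n\<leftarrow>map snd l. real_of_int n) \<noteq> 0"
      using l(2) by (force simp: reduced_syllables_def prod_list_zero_iff)
    ultimately show ?thesis
      using l(2) coeff_syllables_value[of l "h \<circ> e"] by (auto simp: reduced_syllables_def)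
  qed
  moreover have "h k (map fst l) = 0" if "k \<in> generate G (e ` Y)" for k
  proof -
    have "f y \<in> series_over Y" if "y \<in> Y" for y
      using that by (intro f \<phi>(3)) auto
    then have "h ` e ` Y \<subseteq> series_over Y"
      using h(3) YX by auto
    then have "h k \<in> series_over Y"
      using that by (intro hom_generate_in_subgroup[OF G group_series_group h(1) subgroup_series_over eY])
    \<comment> \<open>The word \<open>map fst l\<close> contains a letter outside \<open>Y\<close>,
      so its coefficient is 0 in every series over \<open>Y\<close>.\<close>
    then show ?thesis
      using \<open>\<not> L \<subseteq> Y\<close> by (simp add: series_over_def L_def)
  qed
  moreover have "continuous_map T euclideanreal (\<lambda>k. h k (map fst l))"
    using h(2) by (simp add: continuous_map_series_topology)
  ultimately show ?thesis by blast
qed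

section \<open>The Abelian case\<close>

definition real_add_group :: "real monoid" where
  "real_add_group = \<lparr>carrier = UNIV, mult = (+), one = 0\<rparr>"

lemma real_add_group_simps [simp]:
  "carrier real_add_group = UNIV"
  "a \<otimes>\<^bsub>real_add_group\<^esub> b = a + b"
  "\<one>\<^bsub>real_add_group\<^esub> = 0"
  by (simp_all add: real_add_group_def)

lemma comm_group_real_add_group: "comm_group real_add_group"
  by (rule comm_groupI) (auto intro: exI[of _ "- x" for x])

lemma inv_real_add_group [simp]: "inv\<^bsub>real_add_group\<^esub> a = - a"
  using comm_group_real_add_group
  by (intro group.inv_equality) (auto simp: comm_group_def)

lemma int_pow_real_add_group [simp]: "a [^]\<^bsub>real_add_group\<^esub> (n :: int) = n * a"
proof -
  have "a [^]\<^bsub>real_add_group\<^esub> (k :: nat) = k * a" for k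
    by (induction k) (auto simp: nat_pow_def algebra_simps)
  then show ?thesis by (simp add: int_pow_def2)
qed

lemma paratopological_group_real: "paratopological_group real_add_group euclideanreal"
proof -
  have "t0_space euclideanreal"
    by (intro t1_imp_t0_space Hausdorff_imp_t1_space Hausdorff_space_euclidean)
  moreover have "continuous_map (prod_topology euclideanreal euclideanreal) euclideanreal
      (\<lambda>(a, b). a + b)"
    by (auto simp: case_prod_unfold intro!: continuous_intros continuous_map_fst continuous_map_snd)
  ultimately show ?thesis
    using comm_group_real_add_group by (simp add: paratopological_group_def comm_group_def)
qed

text \<open>By commutativity the product of the subgroups generated by \<open>a\<close> and by
  \<open>B\<close> is itself a subgroup, and it contains \<open>insert a B\<close>.\<close>

lemma (in comm_group) generate_insert_decomposition:
  assumes "a \<in> carrier G" "B \<subseteq> carrier G" "g \<in> generate G (insert a B)"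
  obtains n :: int and h where "h \<in> generate G B" "g = a [^] n \<otimes> h"
proof -
  let ?S = "generate G {a} <#> generate G B"
  have B: "subgroup (generate G B) G" and A: "subgroup (generate G {a}) G"
    using assms by (auto intro: generate_is_subgroup)
  have "\<one> \<otimes> b \<in> ?S" if "b \<in> B" for b
    using that by (auto simp: set_mult_def intro: generate.intros)
  moreover have "a \<otimes> \<one> \<in> ?S"
    by (auto simp: set_mult_def intro: generate.intros)
  ultimately have "insert a B \<subseteq> ?S"
    using assms(1,2) by (auto simp: subset_iff)
  then have "g \<in> ?S"
    using generate_subgroup_incl[OF _ mult_subgroups[OF A B]] assms(3) by blast
  then show ?thesis
    using that by (auto simp: set_mult_def generate_pow[OF assms(1)])
qed

lemma abelian_separation:
  assumes X: "tychonoff_space X" and Y: "closedin X Y"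
    and AP: "markov_free_abelian_paratopological_group X G T e"
    and g: "g \<in> carrier G - generate G (e ` Y)"
  shows "\<exists>c. continuous_map T euclideanreal c \<and> c g \<noteq> 0 \<and> (\<forall>k\<in>generate G (e ` Y). c k = 0)"
proof -
  have C: "comm_group G" and gen: "generate G (e ` topspace X) = carrier G"
    and eX: "e ` topspace X \<subseteq> carrier G"
    using AP embedding_map_image_subset[of X T e]
    by (auto simp: markov_free_abelian_paratopological_group_def paratopological_group_def)
  interpret comm_group G by fact
  have YX: "Y \<subseteq> topspace X" using Y by (rule closedin_subset)
  obtain l where l: "fst ` set l \<subseteq> topspace X" "syllables_value G e l = g"
    using generate_reduced_syllables[OF is_group eX, of g] g gen by auto
  have *: ?thesis if "finite F" "F \<subseteq> topspace X - Y" "g \<in> generate G (e ` (Y \<union> F))" for F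
    using that
  proof (induction F)
    case empty
    then show ?case using g by simp
  next
    case (insert x F)
    let ?B = "Y \<union> F"
    have BX: "e ` ?B \<subseteq> carrier G" using insert.prems(1) YX eX by blast
    have x: "x \<in> topspace X" "x \<notin> ?B" "e x \<in> carrier G" using insert eX by auto
    obtain n :: int and k where k: "k \<in> generate G (e ` ?B)" "g = e x [^]\<^bsub>G\<^esub> n \<otimes>\<^bsub>G\<^esub> k"
      using generate_insert_decomposition[OF x(3) BX, of g] insert.prems(2) by auto metis
    have kG: "k \<in> carrier G" using k(1) BX generate_in_carrier by blast
    show ?case
    proof (cases "n = 0")
      case True
      then have "g = k" using k kG by simp
      then show ?thesis using insert k by auto
    next
      case False
      have "closedin X F"
        using X insert by (intro closedin_Hausdorff_finite) (auto simp: tychonoff_space_def)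
      then have "closedin X ?B" using Y by auto
      then obtain \<phi> where \<phi>: "continuous_map X euclideanreal \<phi>" "\<phi> x = 1" "\<And>y. y \<in> ?B \<Longrightarrow> \<phi> y = 0"
        using tychonoff_urysohn[OF X, of ?B x] x by blast
      obtain h where h: "h \<in> hom G real_add_group" "continuous_map T euclideanreal h"
        "\<And>x. x \<in> topspace X \<Longrightarrow> h (e x) = \<phi> x"
        using markov_free_abelian_paratopological_group_universal[OF AP comm_group_real_add_group
            paratopological_group_real \<phi>(1)] by metis
      have R: "group real_add_group"
        using comm_group_real_add_group by (simp add: comm_group_def)
      have "subgroup {0} real_add_group"
        by (rule subgroup.intro) auto
      moreover have "h ` e ` ?B \<subseteq> {0}"
        using h(3) \<phi>(3) YX insert.prems(1) by auto
      ultimately have h0: "h k' = 0" if "k' \<in> generate G (e ` ?B)" for k'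
        using hom_generate_in_subgroup[OF is_group R h(1) _ BX _ that] by blast
      \<comment> \<open>The extension \<open>h\<close> kills everything generated by
        \<open>Y\<close> and \<open>F\<close>, and sends \<open>e x\<close> to 1, so its value at
        \<open>g\<close> is the exponent \<open>n\<close>.\<close>
      have "h g = h (e x [^]\<^bsub>G\<^esub> n) + h k"
        using hom_mult[OF h(1), of "e x [^]\<^bsub>G\<^esub> n" k] k(2) kG x(3) by simp
      also have "\<dots> = n"
        using hom_int_pow[OF h(1) x(3) is_group R, of n] h(3)[OF x(1)] \<phi>(2) h0[OF k(1)] by simp
      finally have "h g \<noteq> 0" using False by simp
      moreover have "generate G (e ` Y) \<subseteq> generate G (e ` ?B)"
        by (intro mono_generate) auto
      ultimately show ?thesis using h(2) h0 by blast
    qed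
  qed
  \<comment> \<open>Only finitely many letters occur in \<open>g\<close>; those outside
    \<open>Y\<close> form the initial set \<open>F\<close>.\<close>
  have "g \<in> generate G (e ` (Y \<union> fst ` set l))"
    using l(1) YX eX unfolding l(2)[symmetric]
    by (intro syllables_value_in_subgroup is_group generate_is_subgroup) (force intro: generate.incl)+
  then show ?thesis
    using l(1) by (intro *[of "fst ` set l - Y"]) auto
qed

theorem theorem3p13:
  fixes X :: "'x topology" and Y :: "'x set"
    and G :: "('g, 'm) monoid_scheme" and T :: "'g topology" and e :: "'x \<Rightarrow> 'g"
  assumes "tychonoff_space X"
    and "closedin X Y"
    and "markov_free_paratopological_group X G T e \<or>
         markov_free_abelian_paratopological_group X G T e"
  shows "closedin T (generate G (e ` Y))"
proof (rule closedin_real_separated)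
  have G: "group G" and top: "topspace T = carrier G" and "embedding_map X T e"
    using assms(3)
    by (auto simp: markov_free_paratopological_group_def markov_free_abelian_paratopological_group_def
        paratopological_group_def)
  then have "e ` Y \<subseteq> carrier G"
    using embedding_map_image_subset[of X T e] closedin_subset[OF assms(2)] by auto
  then show "generate G (e ` Y) \<subseteq> topspace T"
    using group.generate_incl[OF G] top by simp
  fix g assume "g \<in> topspace T - generate G (e ` Y)"
  then show "\<exists>c. continuous_map T euclideanreal c \<and> c g \<noteq> 0 \<and> (\<forall>k\<in>generate G (e ` Y). c k = 0)"
    using assms free_separation abelian_separation top by metis
qed

end
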